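(* Let $h:\mathbb{C}\to\mathbb{R}$ be a smooth function such that $e^{-h(w)}\,dw\,d\bar w$ is a flat metric on $\mathbb{C}$. Then the metric $K_h$ on $\mathbb{C}^2$, with coordinates $(z,w)$, defined by the coefficient matrix $$K_h=\begin{pmatrix} e^{h(w)} & \bar z\,\dfrac{\partial e^{h(w)}}{\partial\bar w}\\[0.9em] z\,\dfrac{\partial e^{h(w)}}{\partial w} & |z|^2\dfrac{\partial^2 e^{h(w)}}{\partial w\,\partial\bar w}+e^{-h(w)}\end{pmatrix}$$ is a flat Kähler metric on $\mathbb{C}^2$ such that $\det K_h=1$.
   Context: The matrix entries are the coefficients $g_{\alpha\bar\beta}$ of a Hermitian metric, with rows indexed by $z,w$ and columns by $\bar z,\bar w$. Derivatives are Wirtinger derivatives. A metric is flat if its curvature tensor (that of the Levi-Civita connection) vanishes identically. *)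

theory Defs
  imports "HOL-Analysis.Analysis"
begin

text \<open>
  All derivatives are real Frechet derivatives; \<open>\<complex>\<close> and \<open>\<complex>\<^sup>n\<close> (the type \<open>complex ^ 'n\<close>) are
  regarded as Euclidean spaces, with a single global chart.
\<close>

definition dir_deriv ::
    "('a::real_normed_vector \<Rightarrow> 'b::real_normed_vector) \<Rightarrow> 'a \<Rightarrow> 'a \<Rightarrow> 'b" where
  "dir_deriv f p v = frechet_derivative f (at p) v"

text \<open>On a finite-dimensional domain, \<open>C_diff k f\<close> says that \<open>f\<close> is of class \<open>C\<^sup>k\<close>.\<close>

primrec C_diff :: "nat \<Rightarrow> ('a::euclidean_space \<Rightarrow> 'b::real_normed_vector) \<Rightarrow> bool" where
  "C_diff 0 f \<longleftrightarrow> continuous_on UNIV f"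
| "C_diff (Suc k) f \<longleftrightarrow> (\<forall>p. f differentiable (at p)) \<and> (\<forall>v. C_diff k (\<lambda>p. dir_deriv f p v))"

definition smooth :: "('a::euclidean_space \<Rightarrow> 'b::real_normed_vector) \<Rightarrow> bool" where
  "smooth f \<longleftrightarrow> (\<forall>k. C_diff k f)"

definition wirtinger :: "(complex \<Rightarrow> complex) \<Rightarrow> complex \<Rightarrow> complex" where
  "wirtinger f w = (dir_deriv f w 1 - \<i> * dir_deriv f w \<i>) / 2"

definition wirtinger_bar :: "(complex \<Rightarrow> complex) \<Rightarrow> complex \<Rightarrow> complex" where
  "wirtinger_bar f w = (dir_deriv f w 1 + \<i> * dir_deriv f w \<i>) / 2"


section \<open>The Levi-Civita connection and its curvature\<close>

text \<open>A metric is a function \<open>g\<close>, where \<open>g p u v\<close> is the product of the tangent vectors \<open>u\<close> and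
  \<open>v\<close> at the point \<open>p\<close>.\<close>

definition riemannian_metric :: "('a::euclidean_space \<Rightarrow> 'a \<Rightarrow> 'a \<Rightarrow> real) \<Rightarrow> bool" where
  "riemannian_metric g \<longleftrightarrow>
     (\<forall>u v. smooth (\<lambda>p. g p u v)) \<and>
     (\<forall>p. bilinear (g p)) \<and>
     (\<forall>p u v. g p u v = g p v u) \<and>
     (\<forall>p u. u \<noteq> 0 \<longrightarrow> g p u u > 0)"

text \<open>
  \<open>christoffel g p u v\<close> is the vector whose components are \<open>\<Gamma>\<^sup>k\<^sub>i\<^sub>j u\<^sup>i v\<^sup>j\<close>, that is, the value at \<open>p\<close>
  of the covariant derivative of the constant field \<open>v\<close> along \<open>u\<close>. The defining equation is
  Koszul's formula for constant fields.
\<close>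

definition christoffel :: "('a::euclidean_space \<Rightarrow> 'a \<Rightarrow> 'a \<Rightarrow> real) \<Rightarrow> 'a \<Rightarrow> 'a \<Rightarrow> 'a \<Rightarrow> 'a" where
  "christoffel g p u v = (THE c. \<forall>x. g p c x =
     (dir_deriv (\<lambda>q. g q v x) p u + dir_deriv (\<lambda>q. g q u x) p v
       - dir_deriv (\<lambda>q. g q u v) p x) / 2)"

definition cov_deriv ::
    "('a::euclidean_space \<Rightarrow> 'a \<Rightarrow> 'a \<Rightarrow> real) \<Rightarrow> ('a \<Rightarrow> 'a) \<Rightarrow> ('a \<Rightarrow> 'a) \<Rightarrow> 'a \<Rightarrow> 'a" where
  "cov_deriv g X Y p = dir_deriv Y p (X p) + christoffel g p (X p) (Y p)"

definition lie_bracket :: "('a::euclidean_space \<Rightarrow> 'a) \<Rightarrow> ('a \<Rightarrow> 'a) \<Rightarrow> 'a \<Rightarrow> 'a" where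
  "lie_bracket X Y p = dir_deriv Y p (X p) - dir_deriv X p (Y p)"

definition curvature ::
    "('a::euclidean_space \<Rightarrow> 'a \<Rightarrow> 'a \<Rightarrow> real) \<Rightarrow> ('a \<Rightarrow> 'a) \<Rightarrow> ('a \<Rightarrow> 'a) \<Rightarrow> ('a \<Rightarrow> 'a) \<Rightarrow> 'a \<Rightarrow> 'a"
  where
  "curvature g X Y Z p = cov_deriv g X (cov_deriv g Y Z) p - cov_deriv g Y (cov_deriv g X Z) p
     - cov_deriv g (lie_bracket X Y) Z p"

text \<open>Since the curvature is tensorial, its value on tangent vectors at \<open>p\<close> may be computed by
  extending them to constant vector fields.\<close>

definition curvature_tensor ::
    "('a::euclidean_space \<Rightarrow> 'a \<Rightarrow> 'a \<Rightarrow> real) \<Rightarrow> 'a \<Rightarrow> 'a \<Rightarrow> 'a \<Rightarrow> 'a \<Rightarrow> 'a" where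
  "curvature_tensor g p u v w = curvature g (\<lambda>_. u) (\<lambda>_. v) (\<lambda>_. w) p"


text \<open>The next lemmas confirm that \<open>cov_deriv g\<close> is the Levi-Civita connection of \<open>g\<close>: it is
  torsion-free and compatible with the metric.\<close>

lemma smooth_differentiable: "smooth f \<Longrightarrow> f differentiable (at p)"
  unfolding smooth_def by (metis C_diff.simps(2))

lemma linear_dir_deriv: "f differentiable (at p) \<Longrightarrow> linear (dir_deriv f p)"
  unfolding dir_deriv_def [abs_def] by (simp add: linear_frechet_derivative)

lemma riesz_nondegenerate:
  fixes B :: "'a::euclidean_space \<Rightarrow> 'a \<Rightarrow> real"
  assumes "bilinear B" and pos: "\<And>u. u \<noteq> 0 \<Longrightarrow> B u u > 0" and "linear \<phi>"
  shows "\<exists>!c. \<forall>x. B c x = \<phi> x"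
proof -
  define A where "A c = (\<Sum>b\<in>Basis. B c b *\<^sub>R b)" for c
  have A: "A c \<bullet> x = B c x" for c x
  proof -
    have l: "linear (B c)" using \<open>bilinear B\<close> by (auto simp: bilinear_def)
    have "B c x = B c (\<Sum>b\<in>Basis. (x \<bullet> b) *\<^sub>R b)" by (simp add: euclidean_representation)
    also have "\<dots> = (\<Sum>b\<in>Basis. (x \<bullet> b) * B c b)"
      using l by (simp add: linear_sum linear_scale)
    finally show ?thesis
      by (simp add: A_def inner_sum_left inner_commute[of x] mult.commute)
  qed
  have linA: "linear A"
  proof (rule linearI)
    fix a b :: 'a and r :: real
    show "A (a + b) = A a + A b"
      by (rule vector_eq_rdot[THEN iffD1])
         (simp add: A inner_add_left bilinear_ladd[OF \<open>bilinear B\<close>])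
    show "A (r *\<^sub>R a) = r *\<^sub>R A a"
      by (rule vector_eq_rdot[THEN iffD1])
         (simp add: A bilinear_lmul[OF \<open>bilinear B\<close>])
  qed
  have "inj A"
    unfolding linear_injective_0[OF linA] by (metis A inner_zero_left less_irrefl pos)
  have "surj A" using linA \<open>inj A\<close> by (simp add: linear_injective_imp_surjective)
  have \<phi>: "\<phi> x = (\<Sum>b\<in>Basis. \<phi> b *\<^sub>R b) \<bullet> x" for x
  proof -
    have "\<phi> x = \<phi> (\<Sum>b\<in>Basis. (x \<bullet> b) *\<^sub>R b)" by (simp add: euclidean_representation)
    also have "\<dots> = (\<Sum>b\<in>Basis. (x \<bullet> b) * \<phi> b)"
      using \<open>linear \<phi>\<close> by (simp add: linear_sum linear_scale)
    finally show ?thesis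
      by (simp add: inner_sum_left inner_commute[of x] mult.commute)
  qed
  obtain c where "A c = (\<Sum>b\<in>Basis. \<phi> b *\<^sub>R b)" using \<open>surj A\<close> by (metis surjD)
  then have "\<forall>x. B c x = \<phi> x" by (metis A \<phi>)
  moreover have "c' = c" if "\<forall>x. B c' x = \<phi> x" for c'
    using that calculation \<open>inj A\<close> by (metis A injD vector_eq_rdot)
  ultimately show ?thesis by blast
qed

lemma christoffel_koszul:
  assumes g: "riemannian_metric g"
  shows "g p (christoffel g p u v) x =
     (dir_deriv (\<lambda>q. g q v x) p u + dir_deriv (\<lambda>q. g q u x) p v
       - dir_deriv (\<lambda>q. g q u v) p x) / 2"
proof -
  have d: "(\<lambda>q. g q a b) differentiable (at p)" for a b
    using g by (simp add: riemannian_metric_def smooth_differentiable)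
  have bil: "bilinear (g q)" for q using g by (simp add: riemannian_metric_def)
  have fd: "((\<lambda>q. g q a b) has_derivative dir_deriv (\<lambda>q. g q a b) p) (at p)" for a b
    using d frechet_derivative_works unfolding dir_deriv_def [abs_def] by blast
  have add: "dir_deriv (\<lambda>q. g q a (b + c)) p w
      = dir_deriv (\<lambda>q. g q a b) p w + dir_deriv (\<lambda>q. g q a c) p w" for a b c w
  proof -
    have "((\<lambda>q. g q a (b + c)) has_derivative
        (\<lambda>w. dir_deriv (\<lambda>q. g q a b) p w + dir_deriv (\<lambda>q. g q a c) p w)) (at p)"
      unfolding bilinear_radd[OF bil] by (intro has_derivative_add fd)
    then show ?thesis by (rule has_derivative_unique[OF fd, THEN fun_cong])
  qed
  have scale: "dir_deriv (\<lambda>q. g q a (r *\<^sub>R b)) p w = r * dir_deriv (\<lambda>q. g q a b) p w" for a b r w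
  proof -
    have "((\<lambda>q. g q a (r *\<^sub>R b)) has_derivative (\<lambda>w. r * dir_deriv (\<lambda>q. g q a b) p w)) (at p)"
      unfolding bilinear_rmul[OF bil] real_scaleR_def by (intro has_derivative_mult_right fd)
    then show ?thesis by (rule has_derivative_unique[OF fd, THEN fun_cong])
  qed
  have "linear (\<lambda>x. (dir_deriv (\<lambda>q. g q v x) p u + dir_deriv (\<lambda>q. g q u x) p v
       - dir_deriv (\<lambda>q. g q u v) p x) / 2)"
    using linear_dir_deriv[OF d, of u v]
    by (intro linearI)
       (simp_all add: add scale linear_add linear_scale add_divide_distrib diff_divide_distrib
         right_diff_distrib distrib_left)
  from riesz_nondegenerate[OF bil _ this, of p]
  have "\<exists>!c. \<forall>x. g p c x = (dir_deriv (\<lambda>q. g q v x) p u + dir_deriv (\<lambda>q. g q u x) p v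
       - dir_deriv (\<lambda>q. g q u v) p x) / 2"
    using g by (simp add: riemannian_metric_def)
  from theI'[OF this] show ?thesis unfolding christoffel_def by blast
qed

lemma cov_deriv_torsion_free:
  assumes "riemannian_metric g"
  shows "cov_deriv g X Y p - cov_deriv g Y X p = lie_bracket X Y p"
proof -
  have "(\<lambda>q. g q u v) = (\<lambda>q. g q v u)" for u v
    using assms by (auto simp: riemannian_metric_def)
  then have "dir_deriv (\<lambda>q. g q v x) p u + dir_deriv (\<lambda>q. g q u x) p v
        - dir_deriv (\<lambda>q. g q u v) p x
      = dir_deriv (\<lambda>q. g q u x) p v + dir_deriv (\<lambda>q. g q v x) p u
        - dir_deriv (\<lambda>q. g q v u) p x" for u v x
    by (simp only: add.commute)
  then have "christoffel g p u v = christoffel g p v u" for u v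
    unfolding christoffel_def by (simp only:)
  then show ?thesis by (simp add: cov_deriv_def lie_bracket_def)
qed

lemma cov_deriv_metric_compatible:
  assumes g: "riemannian_metric g"
    and Y: "Y differentiable (at p)" and Z: "Z differentiable (at p)"
  shows "dir_deriv (\<lambda>q. g q (Y q) (Z q)) p (X p)
    = g p (cov_deriv g X Y p) (Z p) + g p (Y p) (cov_deriv g X Z p)"
proof -
  have bil: "bilinear (g q)" for q using g by (simp add: riemannian_metric_def)
  have sym: "g q a b = g q b a" for q a b using g by (simp add: riemannian_metric_def)
  have fd: "((\<lambda>q. g q a b) has_derivative dir_deriv (\<lambda>q. g q a b) p) (at p)" for a b
    using g frechet_derivative_works smooth_differentiable
    unfolding dir_deriv_def [abs_def] riemannian_metric_def by blast
  have Y': "(Y has_derivative dir_deriv Y p) (at p)" and Z': "(Z has_derivative dir_deriv Z p) (at p)"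
    using Y Z frechet_derivative_works unfolding dir_deriv_def [abs_def] by blast+
  have expand: "g q a b = (\<Sum>i\<in>Basis. \<Sum>j\<in>Basis. (a \<bullet> i) * (b \<bullet> j) * g q i j)" for q a b
  proof -
    have "g q a b = g q (\<Sum>i\<in>Basis. (a \<bullet> i) *\<^sub>R i) (\<Sum>j\<in>Basis. (b \<bullet> j) *\<^sub>R j)"
      by (simp add: euclidean_representation)
    then show ?thesis
      by (simp add: bilinear_sum[OF bil] bilinear_lmul[OF bil] bilinear_rmul[OF bil]
          sum.cartesian_product mult.assoc mult.left_commute)
  qed
  have dg: "dir_deriv (\<lambda>q. g q a b) p w
      = (\<Sum>i\<in>Basis. \<Sum>j\<in>Basis. (a \<bullet> i) * (b \<bullet> j) * dir_deriv (\<lambda>q. g q i j) p w)" for a b w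
  proof -
    have "((\<lambda>q. g q a b) has_derivative (\<lambda>w. \<Sum>i\<in>Basis. \<Sum>j\<in>Basis.
        (a \<bullet> i) * (b \<bullet> j) * dir_deriv (\<lambda>q. g q i j) p w)) (at p)"
      by (subst expand) (intro has_derivative_sum has_derivative_mult_right fd)
    then show ?thesis by (rule has_derivative_unique[OF fd, THEN fun_cong])
  qed
  have gYZ: "(\<lambda>q. g q (Y q) (Z q))
      = (\<lambda>q. \<Sum>i\<in>Basis. \<Sum>j\<in>Basis. (Y q \<bullet> i) * (Z q \<bullet> j) * g q i j)"
    by (rule ext) (rule expand)
  have "((\<lambda>q. g q (Y q) (Z q)) has_derivative (\<lambda>w. \<Sum>i\<in>Basis. \<Sum>j\<in>Basis.
      (Y p \<bullet> i) * (Z p \<bullet> j) * dir_deriv (\<lambda>q. g q i j) p w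
      + ((Y p \<bullet> i) * (dir_deriv Z p w \<bullet> j) + (dir_deriv Y p w \<bullet> i) * (Z p \<bullet> j)) * g p i j)) (at p)"
    unfolding gYZ
    by (intro has_derivative_sum has_derivative_mult fd has_derivative_inner_left Y' Z')
  then have "dir_deriv (\<lambda>q. g q (Y q) (Z q)) p = (\<lambda>w. \<Sum>i\<in>Basis. \<Sum>j\<in>Basis.
      (Y p \<bullet> i) * (Z p \<bullet> j) * dir_deriv (\<lambda>q. g q i j) p w
      + ((Y p \<bullet> i) * (dir_deriv Z p w \<bullet> j) + (dir_deriv Y p w \<bullet> i) * (Z p \<bullet> j)) * g p i j)"
    unfolding dir_deriv_def [abs_def] by (rule frechet_derivative_at[symmetric])
  then have "dir_deriv (\<lambda>q. g q (Y q) (Z q)) p w = dir_deriv (\<lambda>q. g q (Y p) (Z p)) p w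
      + g p (Y p) (dir_deriv Z p w) + g p (dir_deriv Y p w) (Z p)" for w
    by (simp add: dg[of "Y p" "Z p"] expand[of p "Y p" "dir_deriv Z p w"]
        expand[of p "dir_deriv Y p w" "Z p"] sum.distrib algebra_simps)
  moreover have compat: "g p (christoffel g p u a) b + g p a (christoffel g p u b)
      = dir_deriv (\<lambda>q. g q a b) p u" for u a b
  proof -
    have s: "(\<lambda>q. g q u v) = (\<lambda>q. g q v u)" for u v using sym by auto
    show ?thesis
      unfolding sym[of p a "christoffel g p u b"] christoffel_koszul[OF g]
      using s[of a b] s[of a u] s[of b u] by (simp add: field_simps)
  qed
  ultimately show ?thesis
    by (simp add: cov_deriv_def bilinear_ladd[OF bil] bilinear_radd[OF bil] algebra_simps
        flip: compat)
qed


section \<open>Hermitian and Kaehler metrics on complex n-space\<close>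

text \<open>
  A Hermitian metric \<open>\<Sum> g\<^sub>\<alpha>\<^sub>\<beta> dz\<^sub>\<alpha> d(cnj z\<^sub>\<beta>)\<close> is given by its coefficient matrix \<open>G p $ \<alpha> $ \<beta>\<close>,
  where the rows belong to \<open>dz\<^sub>\<alpha>\<close> and the columns to \<open>d(cnj z\<^sub>\<beta>)\<close>.
\<close>

definition hermitian_product :: "complex ^ 'n ^ 'n \<Rightarrow> complex ^ 'n \<Rightarrow> complex ^ 'n \<Rightarrow> complex" where
  "hermitian_product A u v = (\<Sum>\<alpha>\<in>UNIV. \<Sum>\<beta>\<in>UNIV. A $ \<alpha> $ \<beta> * u $ \<alpha> * cnj (v $ \<beta>))"

definition hermitian_metric :: "(complex ^ 'n \<Rightarrow> complex ^ 'n ^ 'n) \<Rightarrow> bool" where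
  "hermitian_metric G \<longleftrightarrow>
     (\<forall>\<alpha> \<beta>. smooth (\<lambda>p. G p $ \<alpha> $ \<beta>)) \<and>
     (\<forall>p \<alpha> \<beta>. G p $ \<beta> $ \<alpha> = cnj (G p $ \<alpha> $ \<beta>)) \<and>
     (\<forall>p u. u \<noteq> 0 \<longrightarrow> Re (hermitian_product (G p) u u) > 0)"

text \<open>The normalization is such that \<open>dz d(cnj z)\<close> is the Euclidean metric of the plane;
  other conventions differ by a constant factor, which does not affect curvature.\<close>

definition real_metric ::
    "(complex ^ 'n \<Rightarrow> complex ^ 'n ^ 'n) \<Rightarrow> complex ^ 'n \<Rightarrow> complex ^ 'n \<Rightarrow> complex ^ 'n \<Rightarrow> real" where
  "real_metric G p u v = Re (hermitian_product (G p) u v)"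

definition flat_metric :: "(complex ^ 'n \<Rightarrow> complex ^ 'n ^ 'n) \<Rightarrow> bool" where
  "flat_metric G \<longleftrightarrow> hermitian_metric G \<and>
     (\<forall>p u v w. curvature_tensor (real_metric G) p u v w = 0)"

definition kaehler_form ::
    "(complex ^ 'n \<Rightarrow> complex ^ 'n ^ 'n) \<Rightarrow> complex ^ 'n \<Rightarrow> complex ^ 'n \<Rightarrow> complex ^ 'n \<Rightarrow> real" where
  "kaehler_form G p u v = real_metric G p (\<i> *s u) v"

text \<open>The exterior derivative of a 2-form, evaluated on tangent vectors (extended to constant
  fields).\<close>

definition ext_deriv2 :: "('a::euclidean_space \<Rightarrow> 'a \<Rightarrow> 'a \<Rightarrow> real) \<Rightarrow> 'a \<Rightarrow> 'a \<Rightarrow> 'a \<Rightarrow> 'a \<Rightarrow> real"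
  where
  "ext_deriv2 \<omega> p u v w = dir_deriv (\<lambda>q. \<omega> q v w) p u - dir_deriv (\<lambda>q. \<omega> q u w) p v
     + dir_deriv (\<lambda>q. \<omega> q u v) p w"

definition kaehler_metric :: "(complex ^ 'n \<Rightarrow> complex ^ 'n ^ 'n) \<Rightarrow> bool" where
  "kaehler_metric G \<longleftrightarrow> hermitian_metric G \<and>
     (\<forall>p u v w. ext_deriv2 (kaehler_form G) p u v w = 0)"


section \<open>The metrics associated with h\<close>

text \<open>The metric \<open>e\<^sup>-\<^sup>h dw d(cnj w)\<close> on \<open>\<complex>\<close>, viewed as \<open>complex ^ 1\<close>.\<close>

definition conformal_metric :: "(complex \<Rightarrow> real) \<Rightarrow> complex ^ 1 \<Rightarrow> complex ^ 1 ^ 1" where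
  "conformal_metric h p = (\<chi> \<alpha> \<beta>. complex_of_real (exp (- h (p $ 1))))"

definition K_metric :: "(complex \<Rightarrow> real) \<Rightarrow> complex ^ 2 \<Rightarrow> complex ^ 2 ^ 2" where
  "K_metric h p =
    (let z = p $ 1; w = p $ 2; E = (\<lambda>w. complex_of_real (exp (h w))) in
     vector
      [vector [E w, cnj z * wirtinger_bar E w],
       vector [z * wirtinger E w,
         complex_of_real ((cmod z)\<^sup>2) * wirtinger (wirtinger_bar E) w
           + complex_of_real (exp (- h w))]])"

end

theory Submission
  imports Defs "HOL-Complex_Analysis.Cauchy_Integral_Formula"
begin

text \<open>
  Put \<open>a = \<partial>h/\<partial>w\<close>. The Levi-Civita connection of \<open>e\<^sup>-\<^sup>h dw d(cnj w)\<close> has the complex Christoffel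
  symbol \<open>-a\<close>, and its curvature vanishes exactly when \<open>a\<close> satisfies the Cauchy-Riemann equations.
  Then \<open>K\<^sub>h = e\<^sup>h |dz + z a dw|\<^sup>2 + e\<^sup>-\<^sup>h |dw|\<^sup>2\<close>, which gives the determinant and positivity, and
  \<open>K\<^sub>h\<close> is parallel for a symmetric complex bilinear connection that is polynomial in \<open>z\<close>, \<open>a\<close> and \<open>a'\<close>.
  Symmetry forces this to be the Levi-Civita connection and, with complex linearity, makes the
  metric Kaehler; the curvature is then computed directly.
\<close>

section \<open>Smooth functions\<close>

lemma dir_deriv_eq: "(f has_derivative D) (at p) \<Longrightarrow> dir_deriv f p v = D v"
  unfolding dir_deriv_def by (metis frechet_derivative_at)

lemma has_derivative_dir_deriv:
  "f differentiable (at p) \<Longrightarrow> (f has_derivative dir_deriv f p) (at p)"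
  unfolding dir_deriv_def [abs_def] by (simp add: frechet_derivative_works)

text \<open>Any explicit formula \<open>D\<close> may stand for the derivative, since derivatives
  are unique. The closure lemmas below feed in the sum, product and chain rules and recurse on the
  directional derivatives.\<close>

lemma C_diff_SucI:
  assumes "\<And>p. (f has_derivative D p) (at p)" and "\<And>v. C_diff k (\<lambda>p. D p v)"
  shows "C_diff (Suc k) f"
proof -
  have "(\<lambda>p. dir_deriv f p v) = (\<lambda>p. D p v)" for v
    using dir_deriv_eq[OF assms(1)] by auto
  then show ?thesis
    using assms by (auto simp: differentiable_def)
qed

lemma C_diff_Suc_has_derivative:
  "C_diff (Suc k) f \<Longrightarrow> (f has_derivative dir_deriv f p) (at p)"
  by (simp add: has_derivative_dir_deriv)

text \<open>The recursion in \<open>C_diff\<close> reaches continuity only after the last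
  derivative, so monotonicity in \<open>k\<close> needs an induction. The product rule depends on
  it: undifferentiated factors reappear one level down.\<close>

lemma C_diff_Suc_imp: "C_diff (Suc k) f \<Longrightarrow> C_diff k f"
proof (induction k arbitrary: f)
  case 0
  then show ?case
    by (auto intro!: differentiable_imp_continuous_on simp: differentiable_on_def
        intro: differentiable_at_withinI)
next
  case (Suc k)
  then show ?case by (metis C_diff.simps(2))
qed

lemma C_diff_const: "C_diff k (\<lambda>_. c)"
proof (induction k arbitrary: c)
  case (Suc k)
  show ?case
    by (rule C_diff_SucI[where D = "\<lambda>_ _. 0"]) (auto intro!: derivative_eq_intros Suc)
qed simp

lemma C_diff_linear:
  fixes f :: "'a::euclidean_space \<Rightarrow> 'b::real_normed_vector"
  assumes "bounded_linear f"
  shows "C_diff k f"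
proof (cases k)
  case 0
  then show ?thesis using assms by (simp add: linear_continuous_on)
next
  case (Suc j)
  show ?thesis unfolding Suc
    by (rule C_diff_SucI[where D = "\<lambda>_. f"])
       (auto intro: bounded_linear_imp_has_derivative assms C_diff_const)
qed

lemma C_diff_linear_image:
  assumes L: "bounded_linear L"
  shows "C_diff k f \<Longrightarrow> C_diff k (\<lambda>p. L (f p))"
proof (induction k arbitrary: f)
  case 0
  then show ?case using L by (auto intro: bounded_linear.continuous_on)
next
  case (Suc k)
  show ?case
    by (rule C_diff_SucI[where D = "\<lambda>p v. L (dir_deriv f p v)"])
       (use Suc in \<open>auto intro: bounded_linear.has_derivative[OF L] has_derivative_dir_deriv\<close>)
qed

text \<open>Serves for functions of a single coordinate. As \<open>L v\<close> does not vary with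
  the point, the chain rule yields again a function composed with \<open>L\<close>, and the
  induction hypothesis applies to it.\<close>

lemma C_diff_linear_arg:
  fixes L :: "'a::euclidean_space \<Rightarrow> 'b::euclidean_space"
  assumes L: "bounded_linear L"
  shows "C_diff k f \<Longrightarrow> C_diff k (\<lambda>p. f (L p))"
proof (induction k arbitrary: f)
  case 0
  then show ?case
    by (auto intro: continuous_on_compose2 linear_continuous_on L)
next
  case (Suc k)
  show ?case
  proof (rule C_diff_SucI[where D = "\<lambda>p v. dir_deriv f (L p) (L v)"])
    show "((\<lambda>p. f (L p)) has_derivative (\<lambda>v. dir_deriv f (L p) (L v))) (at p)" for p
      using has_derivative_compose[OF bounded_linear_imp_has_derivative[OF L]
          C_diff_Suc_has_derivative[OF Suc.prems]] .
    show "C_diff k (\<lambda>p. dir_deriv f (L p) (L v))" for v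
      using Suc.prems by (intro Suc.IH) simp
  qed
qed

lemma C_diff_add: "C_diff k f \<Longrightarrow> C_diff k g \<Longrightarrow> C_diff k (\<lambda>p. f p + g p)"
proof (induction k arbitrary: f g)
  case 0
  then show ?case by (auto intro: continuous_on_add)
next
  case (Suc k)
  show ?case
    by (rule C_diff_SucI[where D = "\<lambda>p v. dir_deriv f p v + dir_deriv g p v"])
       (use Suc in \<open>auto intro!: has_derivative_add has_derivative_dir_deriv\<close>)
qed

lemma C_diff_mult:
  fixes f g :: "'a::euclidean_space \<Rightarrow> 'b::real_normed_algebra"
  shows "C_diff k f \<Longrightarrow> C_diff k g \<Longrightarrow> C_diff k (\<lambda>p. f p * g p)"
proof (induction k arbitrary: f g)
  case 0
  then show ?case by (auto intro: continuous_on_mult)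
next
  case (Suc k)
  show ?case
  proof (rule C_diff_SucI)
    show "((\<lambda>p. f p * g p) has_derivative (\<lambda>v. f p * dir_deriv g p v + dir_deriv f p v * g p)) (at p)" for p
      using Suc.prems by (intro has_derivative_mult C_diff_Suc_has_derivative)
    show "C_diff k (\<lambda>p. f p * dir_deriv g p v + dir_deriv f p v * g p)" for v
      using Suc.prems C_diff_Suc_imp[OF Suc.prems(1)] C_diff_Suc_imp[OF Suc.prems(2)]
      by (intro C_diff_add Suc.IH) auto
  qed
qed

text \<open>The exponential is a factor of its own derivative, so the induction runs with
  \<open>f\<close> fixed.\<close>

lemma C_diff_exp:
  fixes f :: "'a::euclidean_space \<Rightarrow> real"
  shows "C_diff k f \<Longrightarrow> C_diff k (\<lambda>p. exp (f p))"
proof (induction k)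
  case 0
  then show ?case by (auto intro: continuous_on_exp)
next
  case (Suc k)
  show ?case
  proof (rule C_diff_SucI)
    show "((\<lambda>p. exp (f p)) has_derivative (\<lambda>v. exp (f p) * dir_deriv f p v)) (at p)" for p
      using C_diff_Suc_has_derivative[OF Suc.prems, of p]
      by (auto intro!: derivative_eq_intros)
    show "C_diff k (\<lambda>p. exp (f p) * dir_deriv f p v)" for v
      using Suc.prems C_diff_Suc_imp[OF Suc.prems] by (intro C_diff_mult Suc.IH) auto
  qed
qed

lemma smooth_dir_deriv: "smooth f \<Longrightarrow> smooth (\<lambda>p. dir_deriv f p v)"
  unfolding smooth_def by (metis C_diff.simps(2))

lemma smooth_const: "smooth (\<lambda>_. c)"
  by (simp add: smooth_def C_diff_const)

lemma smooth_linear: "bounded_linear f \<Longrightarrow> smooth f"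
  by (simp add: smooth_def C_diff_linear)

lemma smooth_linear_image: "bounded_linear L \<Longrightarrow> smooth f \<Longrightarrow> smooth (\<lambda>p. L (f p))"
  by (simp add: smooth_def C_diff_linear_image)

lemma smooth_linear_arg: "bounded_linear L \<Longrightarrow> smooth f \<Longrightarrow> smooth (\<lambda>p. f (L p))"
  by (simp add: smooth_def C_diff_linear_arg)

lemma smooth_add: "smooth f \<Longrightarrow> smooth g \<Longrightarrow> smooth (\<lambda>p. f p + g p)"
  by (simp add: smooth_def C_diff_add)

lemma smooth_mult:
  fixes f g :: "'a::euclidean_space \<Rightarrow> 'b::real_normed_algebra"
  shows "smooth f \<Longrightarrow> smooth g \<Longrightarrow> smooth (\<lambda>p. f p * g p)"
  by (simp add: smooth_def C_diff_mult)

lemma smooth_exp: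
  fixes f :: "'a::euclidean_space \<Rightarrow> real"
  shows "smooth f \<Longrightarrow> smooth (\<lambda>p. exp (f p))"
  by (simp add: smooth_def C_diff_exp)

lemma smooth_wirtinger:
  assumes "smooth f"
  shows "smooth (wirtinger f)" and "smooth (wirtinger_bar f)"
proof -
  have comb: "smooth (\<lambda>w. c * dir_deriv f w u + d * dir_deriv f w v)" for c d u v
    by (intro smooth_add smooth_mult smooth_dir_deriv[OF assms]) (rule smooth_const)+
  have "wirtinger f = (\<lambda>w. 1/2 * dir_deriv f w 1 + (- \<i> / 2) * dir_deriv f w \<i>)"
    by (auto simp: wirtinger_def field_simps)
  then show "smooth (wirtinger f)" by (rule ssubst) (rule comb)
  have "wirtinger_bar f = (\<lambda>w. 1/2 * dir_deriv f w 1 + (\<i> / 2) * dir_deriv f w \<i>)"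
    by (auto simp: wirtinger_bar_def field_simps)
  then show "smooth (wirtinger_bar f)" by (rule ssubst) (rule comb)
qed

text \<open>The real basis \<open>1\<close>, \<open>\<i>\<close> of the plane determines a real
  linear map. This recovers a full derivative from the two directions that Wirtinger derivatives
  see.\<close>

lemma linear_complex_eq:
  assumes "linear f"
  shows "f u = Re u *\<^sub>R f 1 + Im u *\<^sub>R f \<i>"
proof -
  have "u = Re u *\<^sub>R 1 + Im u *\<^sub>R \<i>" by (simp add: complex_eq_iff)
  then have "f u = f (Re u *\<^sub>R 1 + Im u *\<^sub>R \<i>)" by (rule arg_cong)
  then show ?thesis by (simp only: linear_add[OF assms] linear_scale[OF assms])
qed

lemma has_derivative_vector_2:
  fixes f g :: "'a::real_normed_vector \<Rightarrow> complex"
  assumes "(f has_derivative f') F" and "(g has_derivative g') F"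
  shows "((\<lambda>p. vector [f p, g p] :: complex ^ 2) has_derivative (\<lambda>v. vector [f' v, g' v])) F"
proof -
  \<comment> \<open>As a sum of axis vectors, \<open>vector [x, y]\<close> is visibly linear in each
    component.\<close>
  have vec: "vector [x, y] = (axis 1 x + axis 2 y :: complex ^ 2)" for x y
    by (simp add: vec_eq_iff forall_2 axis_def)
  have axis: "bounded_linear (axis i :: complex \<Rightarrow> complex ^ 2)" for i
    by (intro linear_conv_bounded_linear[THEN iffD1] linearI) (simp_all add: vec_eq_iff axis_def)
  show ?thesis
    unfolding vec
    by (rule has_derivative_add[OF bounded_linear.has_derivative[OF axis assms(1)]
          bounded_linear.has_derivative[OF axis assms(2)]])
qed


section \<open>Hermitian metrics with a complex bilinear Levi-Civita connection\<close>

lemma hermitian_product_add_left: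
  "hermitian_product A (u + v) w = hermitian_product A u w + hermitian_product A v w"
  by (simp add: hermitian_product_def algebra_simps sum.distrib)

lemma hermitian_product_add_right:
  "hermitian_product A w (u + v) = hermitian_product A w u + hermitian_product A w v"
  by (simp add: hermitian_product_def algebra_simps sum.distrib)

lemma hermitian_product_scale_left:
  "hermitian_product A (k *s u) v = k * hermitian_product A u v"
  by (simp add: hermitian_product_def sum_distrib_left mult_ac)

lemma hermitian_product_scale_right:
  "hermitian_product A u (k *s v) = cnj k * hermitian_product A u v"
  by (simp add: hermitian_product_def sum_distrib_left mult_ac)

lemma scaleR_eq_vector_scalar_mult:
  fixes u :: "complex ^ 'n"
  shows "r *\<^sub>R u = complex_of_real r *s u"
  by (simp only: vec_eq_iff vector_scaleR_component vector_smult_component)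
     (simp add: scaleR_conv_of_real)

lemma hermitian_product_commute:
  assumes "\<And>\<alpha> \<beta>. A $ \<beta> $ \<alpha> = cnj (A $ \<alpha> $ \<beta>)"
  shows "hermitian_product A v u = cnj (hermitian_product A u v)"
proof -
  have "cnj (hermitian_product A u v) = (\<Sum>\<alpha>\<in>UNIV. \<Sum>\<beta>\<in>UNIV. A $ \<beta> $ \<alpha> * cnj (u $ \<alpha>) * v $ \<beta>)"
    by (simp add: hermitian_product_def assms[symmetric])
  also have "\<dots> = hermitian_product A v u"
    by (subst sum.swap) (simp add: hermitian_product_def mult_ac)
  finally show ?thesis ..
qed

lemma bilinear_real_metric: "bilinear (real_metric G p)"
  by (auto simp: bilinear_def real_metric_def hermitian_product_add_left hermitian_product_add_right
      scaleR_eq_vector_scalar_mult hermitian_product_scale_left hermitian_product_scale_right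
      intro!: linearI)

text \<open>Two solutions of Koszul's equation differ by a vector orthogonal to everything, in
  particular to itself; positivity makes it zero. This discharges the definite description.\<close>

lemma christoffel_eqI:
  assumes bil: "bilinear (g p)" and pos: "\<And>u. u \<noteq> 0 \<Longrightarrow> g p u u > 0"
    and c: "\<And>x. g p c x = (dir_deriv (\<lambda>q. g q v x) p u + dir_deriv (\<lambda>q. g q u x) p v
       - dir_deriv (\<lambda>q. g q u v) p x) / 2"
  shows "christoffel g p u v = c"
  unfolding christoffel_def
proof (rule the_equality)
  show "\<forall>x. g p c x = (dir_deriv (\<lambda>q. g q v x) p u + dir_deriv (\<lambda>q. g q u x) p v
       - dir_deriv (\<lambda>q. g q u v) p x) / 2"
    using c by blast
  fix c' assume "\<forall>x. g p c' x = (dir_deriv (\<lambda>q. g q v x) p u + dir_deriv (\<lambda>q. g q u x) p v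
       - dir_deriv (\<lambda>q. g q u v) p x) / 2"
  then have "g p c' x = g p c x" for x by (simp only: c)
  then have "g p (c' - c) (c' - c) = 0" by (simp add: bilinear_lsub[OF bil])
  then show "c' = c" using pos[of "c' - c"] by force
qed

text \<open>\<open>c\<close> holds the Christoffel symbols of a connection: \<open>deriv\<close> is
  compatibility with the Hermitian product on constant fields, \<open>sym\<close> is vanishing
  torsion, and \<open>scale\<close> says that the connection commutes with the complex
  structure.\<close>

locale hermitian_connection =
  fixes G :: "complex ^ 'n \<Rightarrow> complex ^ 'n ^ 'n"
    and c :: "complex ^ 'n \<Rightarrow> complex ^ 'n \<Rightarrow> complex ^ 'n \<Rightarrow> complex ^ 'n"
  assumes metric: "hermitian_metric G"
    and deriv: "\<And>p v x. ((\<lambda>q. hermitian_product (G q) v x) has_derivative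
        (\<lambda>u. hermitian_product (G p) (c p u v) x + hermitian_product (G p) v (c p u x))) (at p)"
    and sym: "\<And>p u v. c p u v = c p v u"
    and scale: "\<And>p u v k. c p u (k *s v) = k *s c p u v"
begin

lemma commute: "hermitian_product (G p) v u = cnj (hermitian_product (G p) u v)"
  using metric unfolding hermitian_metric_def by (intro hermitian_product_commute) blast

lemma real_metric_commute: "real_metric G p v u = real_metric G p u v"
  unfolding real_metric_def by (subst commute) simp

lemma dir_deriv_real_metric:
  "dir_deriv (\<lambda>q. real_metric G q v x) p u
     = real_metric G p (c p u v) x + real_metric G p v (c p u x)"
proof -
  have "((\<lambda>q. real_metric G q v x) has_derivative
      (\<lambda>u. real_metric G p (c p u v) x + real_metric G p v (c p u x))) (at p)"
    unfolding real_metric_def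
    by (rule has_derivative_eq_rhs[OF has_derivative_Re[OF deriv]]) simp
  then show ?thesis by (rule dir_deriv_eq)
qed

text \<open>Compatibility expands Koszul's right-hand side into six terms. Symmetry of
  \<open>c\<close> and of the metric cancels four of them, and the other two agree.\<close>

lemma christoffel_eq: "christoffel (real_metric G) p u v = c p u v"
proof (rule christoffel_eqI)
  show "real_metric G p u u > 0" if "u \<noteq> 0" for u
    using metric that unfolding real_metric_def hermitian_metric_def by blast
  show "real_metric G p (c p u v) x =
     (dir_deriv (\<lambda>q. real_metric G q v x) p u + dir_deriv (\<lambda>q. real_metric G q u x) p v
       - dir_deriv (\<lambda>q. real_metric G q u v) p x) / 2" for x
    using sym[of p u v] sym[of p x u] sym[of p x v] real_metric_commute[of p v "c p u x"]
    by (simp add: dir_deriv_real_metric)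
qed (rule bilinear_real_metric)

text \<open>By \<open>scale\<close>, the Kaehler form is parallel too. Its exterior derivative
  expands into six terms that cancel in pairs, two pairs by symmetry of \<open>c\<close> and one by
  skewness of the form (\<open>anti\<close>).\<close>

lemma kaehler: "kaehler_metric G"
  unfolding kaehler_metric_def
proof (intro conjI allI metric)
  fix p u v w
  have anti: "real_metric G p (\<i> *s a) b = - real_metric G p (\<i> *s b) a" for a b
    using commute[of p a b] by (simp add: real_metric_def hermitian_product_scale_left)
  show "ext_deriv2 (kaehler_form G) p u v w = 0"
    using sym[of p u v] sym[of p u w] sym[of p v w] anti[of v "c p u w"] anti[of u "c p v w"]
      anti[of w "c p u v"]
    by (simp add: ext_deriv2_def kaehler_form_def dir_deriv_real_metric scale)
qed

lemma curvature_tensor_eq: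
  "curvature_tensor (real_metric G) p u v w =
     dir_deriv (\<lambda>q. c q v w) p u + c p u (c p v w) - (dir_deriv (\<lambda>q. c q u w) p v + c p v (c p u w))"
proof -
  have const: "dir_deriv (\<lambda>_. a) q b = 0" for a :: "complex ^ 'n" and q b :: "complex ^ 'n"
    by (rule dir_deriv_eq) (rule has_derivative_const)
  \<comment> \<open>Constant fields have zero bracket, so the last curvature term reduces to
    \<open>c p 0 w\<close>.\<close>
  have "c p 0 w = 0"
    using scale[of p w 0 0] sym[of p 0 w] by simp
  then show ?thesis
    by (simp add: curvature_tensor_def curvature_def cov_deriv_def [abs_def] lie_bracket_def const
        christoffel_eq)
qed

end


section \<open>The conformal metric and the metric K\<close>

context
  fixes h :: "complex \<Rightarrow> real" and a :: "complex \<Rightarrow> complex"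
  assumes smooth_h: "smooth h"
  defines "a \<equiv> wirtinger (\<lambda>w. complex_of_real (h w))"
begin

section \<open>First derivatives of \<open>h\<close> and of its exponentials\<close>

lemma smooth_of_real_h: "smooth (\<lambda>w. complex_of_real (h w))"
  by (rule smooth_linear_image[OF bounded_linear_of_real smooth_h])

lemma smooth_a: "smooth a"
  unfolding a_def by (rule smooth_wirtinger smooth_of_real_h)+

text \<open>As \<open>h\<close> is real, its derivative in the conjugate variable is the conjugate
  of \<open>a\<close>, so dh = a dw + cnj (a dw).\<close>

lemma has_derivative_h: "(h has_derivative (\<lambda>u. 2 * Re (a w * u))) (at w)"
proof -
  have h: "(h has_derivative dir_deriv h w) (at w)"
    by (intro has_derivative_dir_deriv smooth_differentiable smooth_h)
  then have "dir_deriv (\<lambda>w. complex_of_real (h w)) w u = complex_of_real (dir_deriv h w u)" for u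
    by (intro dir_deriv_eq has_derivative_of_real)
  then have "Re (a w) = dir_deriv h w 1 / 2" "Im (a w) = - dir_deriv h w \<i> / 2"
    by (simp_all add: a_def wirtinger_def)
  then have "dir_deriv h w u = 2 * Re (a w * u)" for u
    using linear_complex_eq[OF has_derivative_linear[OF h], of u] by (simp add: algebra_simps)
  then have "dir_deriv h w = (\<lambda>u. 2 * Re (a w * u))" by (rule ext)
  then show ?thesis using h by simp
qed

text \<open>The real part is split as \<open>a w * u + cnj (a w * u)\<close> so that later
  identities are polynomial in complex quantities and their conjugates.\<close>

lemma has_derivative_exp_h:
  "((\<lambda>w. complex_of_real (exp (h w))) has_derivative
     (\<lambda>u. complex_of_real (exp (h w)) * (a w * u + cnj (a w * u)))) (at w)"
  "((\<lambda>w. complex_of_real (exp (- h w))) has_derivative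
     (\<lambda>u. - (complex_of_real (exp (- h w)) * (a w * u + cnj (a w * u))))) (at w)"
proof -
  have "((\<lambda>w. exp (h w)) has_derivative (\<lambda>u. exp (h w) * (2 * Re (a w * u)))) (at w)"
    by (rule has_derivative_eq_rhs[OF has_derivative_exp[OF has_derivative_h]])
       (simp add: fun_eq_iff)
  from has_derivative_of_real[OF this]
  show "((\<lambda>w. complex_of_real (exp (h w))) has_derivative
     (\<lambda>u. complex_of_real (exp (h w)) * (a w * u + cnj (a w * u)))) (at w)"
    by (simp only: complex_add_cnj of_real_mult)
  have "((\<lambda>w. exp (- h w)) has_derivative (\<lambda>u. exp (- h w) * - (2 * Re (a w * u)))) (at w)"
    by (rule has_derivative_eq_rhs[OF has_derivative_exp[OF has_derivative_minus[OF has_derivative_h]]])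
       (simp add: fun_eq_iff)
  from has_derivative_of_real[OF this]
  show "((\<lambda>w. complex_of_real (exp (- h w))) has_derivative
     (\<lambda>u. - (complex_of_real (exp (- h w)) * (a w * u + cnj (a w * u))))) (at w)"
    by (simp only: complex_add_cnj of_real_mult of_real_minus mult_minus_right)
qed

lemma has_derivative_nth_compose:
  fixes p :: "complex ^ 'n"
  assumes "(f has_derivative f') (at (p $ i))"
  shows "((\<lambda>q. f (q $ i)) has_derivative (\<lambda>u. f' (u $ i))) (at p)"
  by (rule has_derivative_compose[where f = "\<lambda>q. q $ i" and g = f, OF _ assms])
     (intro bounded_linear_imp_has_derivative bounded_linear_vec_nth)

section \<open>The conformal metric: flatness gives holomorphy of \<open>a\<close>\<close>

lemma hermitian_product_conformal_metric:
  "hermitian_product (conformal_metric h p) u v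
    = complex_of_real (exp (- h (p $ 1))) * u $ 1 * cnj (v $ 1)"
  by (simp add: hermitian_product_def conformal_metric_def)

text \<open>The symbol \<open>- a\<close> is the logarithmic w-derivative of
  \<open>exp (- h)\<close>. The two conjugate halves of the derivative of \<open>exp (- h)\<close>
  go to the two slots of the product.\<close>

lemma hermitian_connection_conformal:
  assumes "hermitian_metric (conformal_metric h)"
  shows "hermitian_connection (conformal_metric h) (\<lambda>p u v. vec (- a (p $ 1) * u $ 1 * v $ 1))"
proof
  fix p v x :: "complex ^ 1"
  note e = has_derivative_nth_compose[OF has_derivative_exp_h(2), where p = p and i = 1]
  show "((\<lambda>q. hermitian_product (conformal_metric h q) v x) has_derivative
      (\<lambda>u. hermitian_product (conformal_metric h p) (vec (- a (p $ 1) * u $ 1 * v $ 1)) x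
        + hermitian_product (conformal_metric h p) v (vec (- a (p $ 1) * u $ 1 * x $ 1)))) (at p)"
    unfolding hermitian_product_conformal_metric
    by (rule has_derivative_eq_rhs[OF has_derivative_mult_left[OF has_derivative_mult_left[OF e]]])
       (auto simp: algebra_simps)
qed (use assms in \<open>auto simp: vec_eq_iff\<close>)

lemma holomorphic_a:
  assumes flat: "flat_metric (conformal_metric h)"
  shows "a holomorphic_on UNIV"
proof -
  interpret hermitian_connection "conformal_metric h" "\<lambda>p u v. vec (- a (p $ 1) * u $ 1 * v $ 1)"
    using flat by (intro hermitian_connection_conformal) (simp add: flat_metric_def)
  have "(a has_field_derivative dir_deriv a w 1) (at w)" for w
  proof -
    have a: "(a has_derivative dir_deriv a w) (at w)"
      by (intro has_derivative_dir_deriv smooth_differentiable smooth_a)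
    have c: "((\<lambda>q::complex^1. vec (- a (q $ 1) * v * x) :: complex ^ 1) has_derivative
        (\<lambda>u. vec (- dir_deriv a w (u $ 1) * v * x))) (at (vec w))" for v x
    proof -
      have "((\<lambda>q::complex^1. a (q $ 1)) has_derivative (\<lambda>u. dir_deriv a w (u $ 1))) (at (vec w))"
        by (rule has_derivative_compose[where g = a])
           (auto intro: bounded_linear_imp_has_derivative a)
      then have "((\<lambda>q::complex^1. - a (q $ 1) * v * x) has_derivative
          (\<lambda>u. - dir_deriv a w (u $ 1) * v * x)) (at (vec w))"
        by (auto intro!: derivative_eq_intros)
      moreover have "bounded_linear (vec :: complex \<Rightarrow> complex ^ 1)"
        by (intro linear_conv_bounded_linear[THEN iffD1] linearI) (auto simp: vec_eq_iff)
      ultimately show ?thesis by (rule bounded_linear.has_derivative[rotated])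
    qed
    \<comment> \<open>In complex dimension one the quadratic terms of the curvature cancel. On the
      directions \<open>\<i>\<close> and \<open>1\<close> the rest is the Cauchy-Riemann equation
      for \<open>a\<close>.\<close>
    have "curvature_tensor (real_metric (conformal_metric h)) (vec w) (vec \<i>) (vec 1) (vec 1) = 0"
      using flat by (simp add: flat_metric_def)
    then have "dir_deriv a w \<i> = \<i> * dir_deriv a w 1"
      unfolding curvature_tensor_eq dir_deriv_eq[OF c]
      by (simp add: vec_eq_iff algebra_simps)
    then have "dir_deriv a w u = dir_deriv a w 1 * u" for u
      using linear_complex_eq[OF has_derivative_linear[OF a], of u]
      by (simp add: complex_eq_iff algebra_simps)
    then have "dir_deriv a w = (\<lambda>u. dir_deriv a w 1 * u)" by (rule ext)
    then show ?thesis using a by (simp add: has_field_derivative_def)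
  qed
  then show ?thesis by (auto simp: holomorphic_on_open)
qed

section \<open>The matrix \<open>K_metric h\<close>: entries, smoothness and positivity\<close>

lemma smooth_exp_h: "smooth (\<lambda>w. complex_of_real (exp (h w)))"
  by (intro smooth_linear_image[OF bounded_linear_of_real] smooth_exp smooth_h)

lemma wirtinger_exp_h:
  "wirtinger (\<lambda>w. complex_of_real (exp (h w))) w = complex_of_real (exp (h w)) * a w"
  "wirtinger_bar (\<lambda>w. complex_of_real (exp (h w))) w = complex_of_real (exp (h w)) * cnj (a w)"
  by (simp_all add: wirtinger_def wirtinger_bar_def dir_deriv_eq[OF has_derivative_exp_h(1)] algebra_simps)

text \<open>The conjugate of the holomorphic \<open>a\<close> is annihilated by
  \<open>wirtinger\<close>, so only the exponential is differentiated a second time.\<close>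

lemma wirtinger_wirtinger_bar_exp_h:
  assumes hol: "a holomorphic_on UNIV"
  shows "wirtinger (wirtinger_bar (\<lambda>w. complex_of_real (exp (h w)))) w
    = complex_of_real (exp (h w)) * a w * cnj (a w)"
proof -
  have E: "wirtinger_bar (\<lambda>w. complex_of_real (exp (h w)))
      = (\<lambda>w. complex_of_real (exp (h w)) * cnj (a w))"
    by (rule ext) (rule wirtinger_exp_h)
  have "(a has_derivative (\<lambda>u. deriv a w * u)) (at w)"
    using holomorphic_derivI[OF hol open_UNIV, of w] by (simp add: has_field_derivative_def)
  then have "((\<lambda>w. complex_of_real (exp (h w)) * cnj (a w)) has_derivative
      (\<lambda>u. complex_of_real (exp (h w)) * cnj (deriv a w * u)
        + complex_of_real (exp (h w)) * (a w * u + cnj (a w * u)) * cnj (a w))) (at w)"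
    by (intro has_derivative_mult has_derivative_exp_h(1) has_derivative_cnj)
  from dir_deriv_eq[OF this] show ?thesis
    unfolding wirtinger_def E by (simp add: algebra_simps)
qed

lemma K_metric_entries:
  assumes hol: "a holomorphic_on UNIV"
  defines "E \<equiv> \<lambda>p::complex^2. complex_of_real (exp (h (p $ 2)))"
  shows "K_metric h p $ 1 $ 1 = E p"
    and "K_metric h p $ 1 $ 2 = E p * cnj (p $ 1 * a (p $ 2))"
    and "K_metric h p $ 2 $ 1 = E p * (p $ 1 * a (p $ 2))"
    and "K_metric h p $ 2 $ 2 = E p * (p $ 1 * a (p $ 2)) * cnj (p $ 1 * a (p $ 2)) + inverse (E p)"
  unfolding K_metric_def Let_def wirtinger_exp_h wirtinger_wirtinger_bar_exp_h[OF hol] complex_norm_square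
  by (simp_all add: E_def exp_minus mult_ac)

lemma smooth_K_metric: "smooth (\<lambda>p. K_metric h p $ \<alpha> $ \<beta>)"
proof -
  have z: "smooth (\<lambda>p::complex^2. p $ 1)"
    by (intro smooth_linear bounded_linear_vec_nth)
  have cz: "smooth (\<lambda>p::complex^2. cnj (p $ 1))"
    by (intro smooth_linear_image[OF bounded_linear_cnj] z)
  have w: "smooth (\<lambda>p::complex^2. f (p $ 2))" if "smooth f" for f :: "complex \<Rightarrow> complex"
    by (rule smooth_linear_arg[OF bounded_linear_vec_nth that])
  have "smooth (\<lambda>w. - h w)"
    by (rule smooth_linear_image[OF bounded_linear_minus[OF bounded_linear_ident] smooth_h])
  then have e: "smooth (\<lambda>p::complex^2. complex_of_real (exp (- h (p $ 2))))"
    by (intro w smooth_linear_image[OF bounded_linear_of_real] smooth_exp)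
  have n: "(\<lambda>p::complex^2. complex_of_real ((cmod (p $ 1))\<^sup>2)) = (\<lambda>p. p $ 1 * cnj (p $ 1))"
    by (simp only: complex_norm_square)
  have n: "smooth (\<lambda>p::complex^2. complex_of_real ((cmod (p $ 1))\<^sup>2))"
    unfolding n by (intro smooth_mult z cz)
  have E: "smooth (\<lambda>p::complex^2. complex_of_real (exp (h (p $ 2))))"
    by (rule w[OF smooth_exp_h])
  note E1 = w[OF smooth_wirtinger(1)[OF smooth_exp_h]]
    and E2 = w[OF smooth_wirtinger(2)[OF smooth_exp_h]]
    and E3 = w[OF smooth_wirtinger(1)[OF smooth_wirtinger(2)[OF smooth_exp_h]]]
  have "\<alpha> = 1 \<or> \<alpha> = 2" "\<beta> = 1 \<or> \<beta> = 2" using exhaust_2 by auto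
  then show ?thesis
    unfolding K_metric_def Let_def
    by (elim disjE; simp only: vector_2; intro smooth_add smooth_mult z cz e n E E1 E2 E3)
qed

text \<open>The metric is diagonal in the coframe \<theta> = dz + z a dw, dw, with weights
  \<open>exp h\<close> and \<open>exp (- h)\<close>. Positivity and the connection are computed from
  this form.\<close>

lemma hermitian_product_K_metric:
  assumes hol: "a holomorphic_on UNIV"
  shows "hermitian_product (K_metric h p) u v =
    complex_of_real (exp (h (p $ 2))) * (u $ 1 + p $ 1 * a (p $ 2) * u $ 2)
        * cnj (v $ 1 + p $ 1 * a (p $ 2) * v $ 2)
      + complex_of_real (exp (- h (p $ 2))) * u $ 2 * cnj (v $ 2)"
  by (simp add: hermitian_product_def sum_2 K_metric_entries[OF hol] exp_minus algebra_simps)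

lemma hermitian_metric_K_metric:
  assumes hol: "a holomorphic_on UNIV"
  shows "hermitian_metric (K_metric h)"
  unfolding hermitian_metric_def
proof (intro conjI allI impI smooth_K_metric)
  fix p and \<alpha> \<beta> :: 2
  have "\<alpha> = 1 \<or> \<alpha> = 2" "\<beta> = 1 \<or> \<beta> = 2" using exhaust_2 by auto
  then show "K_metric h p $ \<beta> $ \<alpha> = cnj (K_metric h p $ \<alpha> $ \<beta>)"
    by (elim disjE) (simp_all add: K_metric_entries[OF hol])
next
  fix p u :: "complex ^ 2"
  assume "u \<noteq> 0"
  define \<theta> where "\<theta> = u $ 1 + p $ 1 * a (p $ 2) * u $ 2"
  have eq: "Re (hermitian_product (K_metric h p) u u)
      = exp (h (p $ 2)) * (cmod \<theta>)\<^sup>2 + exp (- h (p $ 2)) * (cmod (u $ 2))\<^sup>2"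
    unfolding hermitian_product_K_metric[OF hol] \<theta>_def[symmetric]
    by (simp add: mult.assoc complex_mult_cnj flip: cmod_power2)
  \<comment> \<open>The coframe is triangular over dz, dw, so its two forms vanish together only on
    the zero vector.\<close>
  have "\<theta> \<noteq> 0 \<or> u $ 2 \<noteq> 0"
    using \<open>u \<noteq> 0\<close> by (auto simp: \<theta>_def vec_eq_iff forall_2)
  then show "Re (hermitian_product (K_metric h p) u u) > 0"
    unfolding eq by (auto intro: add_pos_nonneg add_nonneg_pos)
qed

section \<open>The flat connection of \<open>K_metric h\<close> and the determinant\<close>

text \<open>If \<open>a = f'/f\<close> with \<open>f\<close> holomorphic and \<open>|f|\<^sup>2 = e\<^sup>h\<close>, this is the pullback of the trivial
  connection by \<open>(z, w) \<mapsto> (z f(w), \<integral> dw/f)\<close>, in which \<open>f\<close> occurs only through \<open>a\<close>.\<close>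

definition K_connection :: "complex ^ 2 \<Rightarrow> complex ^ 2 \<Rightarrow> complex ^ 2 \<Rightarrow> complex ^ 2" where
  "K_connection p u v = vector
    [a (p $ 2) * (u $ 1 * v $ 2 + u $ 2 * v $ 1)
       + p $ 1 * (deriv a (p $ 2) + 2 * (a (p $ 2))\<^sup>2) * u $ 2 * v $ 2,
     - a (p $ 2) * u $ 2 * v $ 2]"

text \<open>Each summand of the product is parallel by itself. With c for
  \<open>K_connection p\<close>, \<theta>(c u v) is the derivative of \<theta>(v) along u plus
  \<open>a * u $ 2\<close> times \<theta>(v), which accounts for the derivative of
  \<open>exp h\<close>. Likewise dw(c u v) is \<open>- a * u $ 2 * v $ 2\<close>, which accounts for
  that of \<open>exp (- h)\<close>.\<close>

lemma hermitian_connection_K_metric: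
  assumes hol: "a holomorphic_on UNIV"
  shows "hermitian_connection (K_metric h) K_connection"
proof
  fix p v x :: "complex ^ 2"
  have z: "((\<lambda>q::complex^2. q $ 1) has_derivative (\<lambda>u. u $ 1)) (at p)"
    by (rule has_derivative_nth_compose[OF has_derivative_ident])
  note e = has_derivative_nth_compose[OF has_derivative_exp_h(1), where p = p and i = 2]
    has_derivative_nth_compose[OF has_derivative_exp_h(2), where p = p and i = 2]
  have a: "((\<lambda>q::complex^2. a (q $ 2)) has_derivative (\<lambda>u. deriv a (p $ 2) * u $ 2)) (at p)"
    using holomorphic_derivI[OF hol open_UNIV, of "p $ 2"]
    by (intro has_derivative_nth_compose) (simp add: has_field_derivative_def)
  have \<theta>: "((\<lambda>q. y $ 1 + q $ 1 * a (q $ 2) * y $ 2) has_derivative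
      (\<lambda>u. (p $ 1 * (deriv a (p $ 2) * u $ 2) + u $ 1 * a (p $ 2)) * y $ 2)) (at p)" for y :: "complex ^ 2"
    by (rule has_derivative_eq_rhs[OF has_derivative_add[OF has_derivative_const
          has_derivative_mult_left[OF has_derivative_mult[OF z a]]]]) simp
  show "((\<lambda>q. hermitian_product (K_metric h q) v x) has_derivative
      (\<lambda>u. hermitian_product (K_metric h p) (K_connection p u v) x
        + hermitian_product (K_metric h p) v (K_connection p u x))) (at p)"
    unfolding hermitian_product_K_metric[OF hol]
    by (rule has_derivative_eq_rhs[OF has_derivative_add[OF
          has_derivative_mult[OF has_derivative_mult[OF e(1) \<theta>] has_derivative_cnj[OF \<theta>]]
          has_derivative_mult_left[OF has_derivative_mult_left[OF e(2)]]]])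
       (simp add: K_connection_def fun_eq_iff algebra_simps power2_eq_square)
qed (use hermitian_metric_K_metric[OF hol] in
    \<open>auto simp: K_connection_def vec_eq_iff forall_2 algebra_simps\<close>)

lemma flat_K_metric:
  assumes hol: "a holomorphic_on UNIV"
  shows "flat_metric (K_metric h)"
  unfolding flat_metric_def
proof (intro conjI allI hermitian_metric_K_metric hol)
  interpret hermitian_connection "K_metric h" K_connection
    by (rule hermitian_connection_K_metric[OF hol])
  fix p u v w :: "complex ^ 2"
  have z: "((\<lambda>q::complex^2. q $ 1) has_derivative (\<lambda>u. u $ 1)) (at p)"
    by (rule has_derivative_nth_compose[OF has_derivative_ident])
  have a: "((\<lambda>q::complex^2. a (q $ 2)) has_derivative (\<lambda>u. deriv a (p $ 2) * u $ 2)) (at p)"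
    using holomorphic_derivI[OF hol open_UNIV, of "p $ 2"]
    by (intro has_derivative_nth_compose) (simp add: has_field_derivative_def)
  have "deriv a holomorphic_on UNIV"
    using hol by (simp add: holomorphic_deriv)
  then have a': "((\<lambda>q::complex^2. deriv a (q $ 2)) has_derivative
      (\<lambda>u. deriv (deriv a) (p $ 2) * u $ 2)) (at p)"
    using holomorphic_derivI[OF _ open_UNIV, of "deriv a" "p $ 2"]
    by (intro has_derivative_nth_compose) (simp add: has_field_derivative_def)
  \<comment> \<open>Naming the values at \<open>p\<close> turns flatness into a polynomial
    identity.\<close>
  define A A' A'' z where "A = a (p $ 2)" and "A' = deriv a (p $ 2)"
    and "A'' = deriv (deriv a) (p $ 2)" and "z = p $ 1"
  have D: "((\<lambda>q. K_connection q v w) has_derivative (\<lambda>u. vector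
      [A' * u $ 2 * (v $ 1 * w $ 2 + v $ 2 * w $ 1)
         + (u $ 1 * (A' + 2 * A\<^sup>2) + z * (A'' + 4 * A * A') * u $ 2) * v $ 2 * w $ 2,
       - A' * u $ 2 * v $ 2 * w $ 2])) (at p)" for v w
    unfolding K_connection_def
    by (rule has_derivative_vector_2)
       (rule has_derivative_eq_rhs, (rule derivative_intros z a a')+,
        simp add: A_def A'_def A''_def z_def fun_eq_iff algebra_simps)+
  \<comment> \<open>All terms of the derivative part with \<open>A'\<close> or \<open>A''\<close>
    are symmetric in \<open>u\<close> and \<open>v\<close>, so they drop out. What is left of it, 2
    A^2 (u1 v2 - u2 v1) w2 in the first component, cancels against the quadratic terms; this fixes
    the factor 2 in \<open>K_connection\<close>.\<close>
  show "curvature_tensor (real_metric (K_metric h)) p u v w = 0"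
    unfolding curvature_tensor_eq dir_deriv_eq[OF D]
    by (simp add: K_connection_def vec_eq_iff forall_2 A_def[symmetric] A'_def[symmetric]
        z_def[symmetric] algebra_simps power2_eq_square)
qed

text \<open>The off-diagonal product removes the part of the last entry with \<open>z * a\<close>,
  leaving \<open>exp h\<close> times its inverse.\<close>

lemma det_K_metric:
  assumes hol: "a holomorphic_on UNIV"
  shows "det (K_metric h p) = 1"
  by (simp add: det_2 K_metric_entries[OF hol] algebra_simps)

end

theorem proposition1:
  fixes h :: "complex \<Rightarrow> real"
  assumes "smooth h"
    and "flat_metric (conformal_metric h)"
  shows "kaehler_metric (K_metric h) \<and> flat_metric (K_metric h) \<and> (\<forall>p. det (K_metric h p) = 1)"
proof -
  \<comment> \<open>Flatness of the conformal metric enters as holomorphy of \<open>a\<close>, on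
    which all three conclusions rest.\<close>
  note hol = holomorphic_a[OF assms]
  show ?thesis
    using hermitian_connection.kaehler[OF hermitian_connection_K_metric[OF assms(1) hol]]
      flat_K_metric[OF assms(1) hol] det_K_metric[OF assms(1) hol] by blast
qed

end
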